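(* Let $C$ be a labeled canonical configuration and let $\pi\in G_C$. Then $\pi$ is an even permutation.
   Context: Tokens occupy distinct cells of $\mathbb{Z}^2$ and are regarded as distinct objects (each carries a label). The bounding box is the smallest axis-parallel rectangle containing all tokens; configurations are identified up to translation. A push in direction "left": translate so that the lower-left corner of the bounding box is $(0,0)$; for columns $i=1,2,\dots$ in increasing order and every row $j$, if $(i,j)$ is full and $(i-1,j)$ is empty, move the token from $(i,j)$ to $(i-1,j)$. Pushes in directions right, up, down are defined symmetrically. A configuration is canonical if applying a push in direction left or a push in direction down leaves the set of occupied cells unchanged (up to translation); it is compact if it can be obtained from some canonical configuration by pushes. For a compact configuration $C$, $G_C$ denotes the group of permutations $\pi$ of the set of occupied cells of $C$ such that some finite sequence of pushes transforms $C$ into a configuration with the same set of occupied cells (up to translation) in which, for every occupied cell $p$, the token originally at $p$ is at $\pi(p)$. *)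

theory Defs
  imports "HOL-Combinatorics.Permutations" "HOL-Library.Product_Plus"
begin

type_synonym cell = "int \<times> int"

text \<open>
  A labeled configuration maps each full cell to the label of the token on it, and each empty
  cell to \<open>None\<close>; the set of occupied cells is \<^term>\<open>dom C\<close>.  A first coordinate is a column,
  a second coordinate is a row.
\<close>

type_synonym 'a config = "cell \<Rightarrow> 'a option"

definition configuration :: "'a config \<Rightarrow> bool" where
  "configuration C \<longleftrightarrow> finite (dom C) \<and> inj_on C (dom C)"

definition lower_left :: "'a config \<Rightarrow> cell" where
  "lower_left C = (Min (fst ` dom C), Min (snd ` dom C))"

definition translate :: "cell \<Rightarrow> 'a config \<Rightarrow> 'a config" where
  "translate v C = (\<lambda>p. C (p - v))"

definition move_column :: "int \<Rightarrow> 'a config \<Rightarrow> 'a config" where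
  "move_column i C = (\<lambda>(x, j).
     if C (i, j) \<noteq> None \<and> C (i - 1, j) = None
     then (if x = i - 1 then C (i, j) else if x = i then None else C (x, j))
     else C (x, j))"

text \<open>The empty configuration has no bounding box, but whatever \<^const>\<open>Min\<close> and \<^const>\<open>Max\<close>
  return in that case, the result below is again the empty configuration.\<close>

definition push_left :: "'a config \<Rightarrow> 'a config" where
  "push_left C =
     (let D = translate (- lower_left C) C
      in fold move_column [1..Max (fst ` dom D)] D)"

datatype direction = Left | Right | Up | Down

text \<open>Each of these symmetries of the grid is an involution that exchanges the given direction
  with left, so conjugating \<^const>\<open>push_left\<close> by it yields the push in that direction.\<close>

fun symmetry :: "direction \<Rightarrow> cell \<Rightarrow> cell" where
  "symmetry Left (x, y) = (x, y)"
| "symmetry Right (x, y) = (- x, y)"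
| "symmetry Down (x, y) = (y, x)"
| "symmetry Up (x, y) = (- y, - x)"

definition push :: "direction \<Rightarrow> 'a config \<Rightarrow> 'a config" where
  "push d C = push_left (C \<circ> symmetry d) \<circ> symmetry d"

definition same_shape :: "'a config \<Rightarrow> 'a config \<Rightarrow> bool" where
  "same_shape C D \<longleftrightarrow> (\<exists>v. dom D = (\<lambda>p. p + v) ` dom C)"

definition canonical :: "'a config \<Rightarrow> bool" where
  "canonical C \<longleftrightarrow> configuration C \<and> same_shape C (push Left C) \<and> same_shape C (push Down C)"

definition compact_config :: "'a config \<Rightarrow> bool" where
  "compact_config C \<longleftrightarrow> (\<exists>D ds v. canonical D \<and> C = translate v (fold push ds D))"

lemma canonical_imp_compact_config: "canonical C \<Longrightarrow> compact_config C"
  unfolding compact_config_def translate_def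
  by (rule exI[of _ C], rule exI[of _ "[]"], rule exI[of _ 0]) simp

text \<open>The group \<open>G\<^sub>C\<close>, of interest for compact \<open>C\<close>, as a set of permutations of the
  occupied cells; \<open>v\<close> accounts for configurations being identified up to translation.\<close>

definition push_group :: "'a config \<Rightarrow> (cell \<Rightarrow> cell) set" where
  "push_group C =
     {\<pi>. \<pi> permutes dom C \<and>
         (\<exists>ds v. dom (fold push ds C) = (\<lambda>p. p + v) ` dom C \<and>
                 (\<forall>p \<in> dom C. fold push ds C (\<pi> p + v) = C p))}"

end

theory Submission
  imports Defs
begin

text \<open>
  In a canonical configuration any two rows, as sets of columns, are comparable under inclusion;
  the condition is symmetric in rows and columns, and pushes preserve it, because moving a single
  column acts on all rows by one and the same monotone map.  A horizontal push does not change
  the number \<open>I\<close> of inversions of the labels read row by row, a vertical push does not change the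
  number \<open>I'\<close> of inversions read column by column, and \<open>I + I'\<close> has the parity of the number \<open>N\<close> of
  pairs of tokens one of which lies strictly south-east of the other.  Let \<open>W\<close> be the number of
  pairs \<open>(p, q)\<close> of tokens with \<open>q\<close> in a column to the west of \<open>p\<close> whose cell in the row of \<open>p\<close> is
  empty.  For nested shapes \<open>W\<close> depends only on the heights of the columns, which vertical pushes
  preserve, while \<open>N + W\<close> modulo 2 depends only on the lengths of the rows, which horizontal pushes
  preserve.  Hence the parity of \<open>I + N + W\<close> is invariant under all pushes.  When a sequence of
  pushes restores the shape, \<open>N\<close> and \<open>W\<close> are restored as well, so \<open>I\<close> keeps its parity.
\<close>

section \<open>Counting pairs of cells\<close>

definition pair_count :: "'b set \<Rightarrow> ('b \<Rightarrow> 'b \<Rightarrow> bool) \<Rightarrow> nat" where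
  "pair_count S w = (\<Sum>p\<in>S. \<Sum>q\<in>S. of_bool (w p q))"

lemma pair_count_cong:
  "(\<And>p q. p \<in> S \<Longrightarrow> q \<in> S \<Longrightarrow> w p q = w' p q) \<Longrightarrow> pair_count S w = pair_count S w'"
  unfolding pair_count_def by (intro sum.cong refl) simp

lemma pair_count_image:
  "inj_on m S \<Longrightarrow> pair_count (m ` S) w = pair_count S (\<lambda>p q. w (m p) (m q))"
  unfolding pair_count_def by (simp add: sum.reindex)

lemma pair_count_swap: "pair_count S (\<lambda>p q. w q p) = pair_count S w"
  unfolding pair_count_def by (rule sum.swap)

text \<open>A pair satisfying both \<open>u\<close> and \<open>v\<close> is counted twice on the
  right and not at all on the left.\<close>

lemma even_pair_count_xor:
  "even (pair_count S (\<lambda>p q. u p q \<noteq> v p q)) = even (pair_count S u + pair_count S v)"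
proof -
  have "pair_count S u + pair_count S v
      = (\<Sum>p\<in>S. \<Sum>q\<in>S. of_bool (u p q \<noteq> v p q) + 2 * of_bool (u p q \<and> v p q))"
    unfolding pair_count_def sum.distrib[symmetric] by (intro sum.cong refl) auto
  also have "\<dots> = pair_count S (\<lambda>p q. u p q \<noteq> v p q) + 2 * pair_count S (\<lambda>p q. u p q \<and> v p q)"
    unfolding pair_count_def sum.distrib by (simp only: sum_distrib_left)
  finally show ?thesis by simp
qed

lemma pair_count_insert:
  assumes "finite S" "a \<notin> S"
  shows "pair_count (insert a S) w
    = pair_count S w + of_bool (w a a) + (\<Sum>q\<in>S. of_bool (w a q) + of_bool (w q a))"
  using assms unfolding pair_count_def by (simp add: sum.distrib del: sum_of_bool_eq)

section \<open>The sign of a permutation as the parity of its inversions\<close>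

definition inversions :: "('b \<Rightarrow> 'b \<Rightarrow> bool) \<Rightarrow> ('b \<Rightarrow> nat) \<Rightarrow> 'b set \<Rightarrow> nat" where
  "inversions r g S = pair_count S (\<lambda>p q. r p q \<and> g q < g p)"

text \<open>Exchanging the labels at \<open>a\<close> and \<open>b\<close> flips the status of the
  pair formed by these two positions, while the number of inversions against any third position
  keeps its parity.\<close>

lemma inversions_transpose:
  assumes fin: "finite S" and inj: "inj_on g S" and ab: "a \<in> S" "b \<in> S" "a \<noteq> b"
    and tot: "\<And>p q. p \<in> S \<Longrightarrow> q \<in> S \<Longrightarrow> p \<noteq> q \<Longrightarrow> r p q \<longleftrightarrow> \<not> r q p"
  shows "even (inversions r (g \<circ> transpose a b) S) \<longleftrightarrow> odd (inversions r g S)"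
proof -
  define T where "T = S - {a, b}"
  have S: "S = insert a (insert b T)" and T: "finite T" "a \<notin> T" "b \<notin> T" "a \<notin> insert b T"
    using ab fin by (auto simp: T_def)
  define w where "w h p q \<longleftrightarrow> r p q \<and> h q < h p" for h :: "'a \<Rightarrow> nat" and p q
  let ?g = "g \<circ> transpose a b"
  have split: "inversions r h S = pair_count T (w h)
      + (\<Sum>c\<in>T. of_bool (w h a c) + of_bool (w h c a) + (of_bool (w h b c) + of_bool (w h c b)))
      + (of_bool (w h a b) + of_bool (w h b a))" for h
    unfolding inversions_def w_def[symmetric] S
    using T by (simp add: pair_count_insert sum.distrib del: sum_of_bool_eq) (simp add: w_def)
  have 1: "pair_count T (w ?g) = pair_count T (w g)"
    using T by (intro pair_count_cong) (auto simp: w_def transpose_def)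
  \<comment> \<open>Whether a position and a label are inverted against \<open>c\<close> is, up to
    negation, the exclusive or of a position bit and a label bit. Over the four combinations of a
    position and a label from \<open>a\<close>, \<open>b\<close>, each bit occurs twice.\<close>
  have "even (of_bool (w ?g a c) + of_bool (w ?g c a) + (of_bool (w ?g b c) + of_bool (w ?g c b)) +
      (of_bool (w g a c) + of_bool (w g c a) + (of_bool (w g b c) + of_bool (w g c b))) :: nat)"
    if c: "c \<in> T" for c
  proof -
    have "c \<noteq> a" "c \<noteq> b" "c \<in> S" using c T S by auto
    then have "r c a \<longleftrightarrow> \<not> r a c" "r c b \<longleftrightarrow> \<not> r b c" "g c \<noteq> g a" "g c \<noteq> g b"
      using tot[of c a] tot[of c b] ab by (simp_all add: inj_on_eq_iff[OF inj])
    then show ?thesis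
      using \<open>c \<noteq> a\<close> \<open>c \<noteq> b\<close> by (cases "g a < g c"; cases "g b < g c") (auto simp: w_def)
  qed
  then have "even (\<Sum>c\<in>T. of_bool (w ?g a c) + of_bool (w ?g c a) + (of_bool (w ?g b c) + of_bool (w ?g c b)) +
      (of_bool (w g a c) + of_bool (w g c a) + (of_bool (w g b c) + of_bool (w g c b))) :: nat)"
    by (intro dvd_sum)
  then have 2: "even ((\<Sum>c\<in>T. of_bool (w ?g a c) + of_bool (w ?g c a) + (of_bool (w ?g b c) + of_bool (w ?g c b))) +
      (\<Sum>c\<in>T. of_bool (w g a c) + of_bool (w g c a) + (of_bool (w g b c) + of_bool (w g c b))) :: nat)"
    unfolding sum.distrib[symmetric] .
  have "r a b \<longleftrightarrow> \<not> r b a" "g a \<noteq> g b"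
    using tot[of a b] ab by (simp_all add: inj_on_eq_iff[OF inj])
  then have 3: "odd (of_bool (w ?g a b) + of_bool (w ?g b a) + (of_bool (w g a b) + of_bool (w g b a)) :: nat)"
    using ab by (cases "g a < g b") (auto simp: w_def)
  show ?thesis
    using 1 2 3 unfolding split by (simp only: even_add) blast
qed

text \<open>When \<open>\<pi>\<close> is built from transpositions, each factor flips both the sign
  and the parity of the inversions. The count for \<open>g\<close> is the reference value that makes
  the sum even for the identity.\<close>

lemma inversions_permutes:
  assumes fin: "finite S" and "\<pi> permutes S" and inj: "inj_on g S"
    and tot: "\<And>p q. p \<in> S \<Longrightarrow> q \<in> S \<Longrightarrow> p \<noteq> q \<Longrightarrow> r p q \<longleftrightarrow> \<not> r q p"
  shows "evenperm \<pi> \<longleftrightarrow> even (inversions r (g \<circ> \<pi>) S + inversions r g S)"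
  using fin \<open>\<pi> permutes S\<close> inj
proof (induction arbitrary: g rule: permutes_rev_induct)
  case id
  then show ?case by (simp add: evenperm_id)
next
  case (swap a b p)
  have p: "permutation p" using swap fin permutation_permutes by blast
  have inj': "inj_on (g \<circ> p) S"
    using swap permutes_image[of p S] by (intro comp_inj_on) (auto intro: permutes_inj_on)
  have "evenperm (p \<circ> transpose a b) \<longleftrightarrow> \<not> evenperm p"
    using p \<open>a \<noteq> b\<close> by (simp add: evenperm_comp evenperm_swap permutation_swap_id)
  moreover have "even (inversions r (g \<circ> p \<circ> transpose a b) S) \<longleftrightarrow> odd (inversions r (g \<circ> p) S)"
    using swap by (intro inversions_transpose fin inj' tot) auto
  moreover have "evenperm p \<longleftrightarrow> even (inversions r (g \<circ> p) S + inversions r g S)"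
    using swap by blast
  ultimately show ?case
    by (simp only: even_add comp_assoc) blast
qed

section \<open>Row-first and column-first inversions\<close>

text \<open>With \<open>b = snd\<close> and \<open>a = fst\<close> this is the order row by row.\<close>

definition lex_before :: "('b \<Rightarrow> int) \<Rightarrow> ('b \<Rightarrow> int) \<Rightarrow> 'b \<Rightarrow> 'b \<Rightarrow> bool" where
  "lex_before b a p q \<longleftrightarrow> b p < b q \<or> b p = b q \<and> a p < a q"

text \<open>These are the pairs on which the two reading orders disagree: row by row
  \<open>p\<close> comes first, column by column \<open>q\<close> does.\<close>

definition south_east :: "cell \<Rightarrow> cell \<Rightarrow> bool" where
  "south_east p q \<longleftrightarrow> fst q < fst p \<and> snd p < snd q"

text \<open>Where the reading orders agree on two tokens, both or neither see an inversion; where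
  they disagree, exactly one does, because the labels differ.\<close>

lemma even_row_col_inversions:
  assumes "inj_on g S"
  shows "even (inversions (lex_before snd fst) g S + inversions (lex_before fst snd) g S
    + pair_count S south_east)"
proof -
  let ?u = "\<lambda>p q. lex_before snd fst p q \<and> g q < g p"
  let ?v = "\<lambda>p q. lex_before fst snd p q \<and> g q < g p"
  let ?w = "\<lambda>p q. south_east p q \<and> g q < g p"
  let ?w' = "\<lambda>p q. south_east p q \<and> g p < g q"
  have "even (inversions (lex_before snd fst) g S + inversions (lex_before fst snd) g S)
      = even (pair_count S (\<lambda>p q. ?u p q \<noteq> ?v p q))"
    unfolding inversions_def even_pair_count_xor ..
  \<comment> \<open>With \<open>g q < g p\<close> and disagreeing orders, either \<open>p\<close> is
    south-east of \<open>q\<close> or the reverse. The reverse case is \<open>?w'\<close> with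
    exchanged arguments, which has the same count as \<open>?w'\<close>.\<close>
  also have "pair_count S (\<lambda>p q. ?u p q \<noteq> ?v p q) = pair_count S (\<lambda>p q. ?w p q \<noteq> ?w' q p)"
    by (intro pair_count_cong) (auto simp: lex_before_def south_east_def prod_eq_iff)
  also have "even \<dots> = even (pair_count S ?w + pair_count S ?w')"
    unfolding even_pair_count_xor by (subst (2) pair_count_swap[symmetric]) simp
  also have "\<dots> = even (pair_count S (\<lambda>p q. ?w p q \<noteq> ?w' p q))"
    unfolding even_pair_count_xor ..
  also have "pair_count S (\<lambda>p q. ?w p q \<noteq> ?w' p q) = pair_count S south_east"
  proof (intro pair_count_cong)
    fix p q assume "p \<in> S" "q \<in> S"
    then have "p \<noteq> q \<Longrightarrow> g p \<noteq> g q" using assms by (auto dest: inj_onD)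
    then show "(?w p q \<noteq> ?w' p q) = south_east p q"
      by (cases "p = q") (auto simp: south_east_def)
  qed
  finally show ?thesis by simp
qed

section \<open>Nested shapes\<close>

text \<open>No two rows and two columns have exactly one diagonal of their four crossings occupied.
  This form treats rows and columns alike; up to reordering of lines, such finite shapes are Young
  diagrams.\<close>

definition nested :: "cell set \<Rightarrow> bool" where
  "nested S \<longleftrightarrow> (\<forall>x j x' k. (x, j) \<in> S \<longrightarrow> (x', k) \<in> S \<longrightarrow> (x', j) \<in> S \<or> (x, k) \<in> S)"

definition row :: "cell set \<Rightarrow> int \<Rightarrow> int set" where
  "row S j = {x. (x, j) \<in> S}"

definition column :: "cell set \<Rightarrow> int \<Rightarrow> int set" where
  "column S i = {y. (i, y) \<in> S}"

lemma nested_iff_rows: "nested S \<longleftrightarrow> (\<forall>j k. row S j \<subseteq> row S k \<or> row S k \<subseteq> row S j)"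
  unfolding nested_def row_def by blast

lemma nested_rows: "nested S \<Longrightarrow> row S j \<subseteq> row S k \<or> row S k \<subseteq> row S j"
  unfolding nested_iff_rows by blast

lemma nested_columns: "nested S \<Longrightarrow> column S i \<subseteq> column S k \<or> column S k \<subseteq> column S i"
  unfolding nested_def column_def by blast

lemma finite_row: "finite S \<Longrightarrow> finite (row S j)"
  by (rule finite_subset[of _ "fst ` S"]) (force simp: row_def)+

lemma finite_column: "finite S \<Longrightarrow> finite (column S i)"
  by (rule finite_subset[of _ "snd ` S"]) (force simp: column_def)+

lemma card_row: "card (row S j) = card {p \<in> S. snd p = j}"
proof -
  have "{p \<in> S. snd p = j} = (\<lambda>x. (x, j)) ` row S j" by (force simp: row_def)
  then show ?thesis by (simp add: card_image inj_on_def)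
qed

lemma card_column: "card (column S i) = card {p \<in> S. fst p = i}"
proof -
  have "{p \<in> S. fst p = i} = (\<lambda>y. (i, y)) ` column S i" by (force simp: column_def)
  then show ?thesis by (simp add: card_image inj_on_def)
qed

lemma sum_by_columns:
  assumes "finite S"
  shows "sum f S = (\<Sum>i\<in>fst ` S. \<Sum>y\<in>column S i. f (i, y))"
proof -
  have "S = Sigma (fst ` S) (column S)" by (force simp: column_def)
  then have "sum f S = sum f (Sigma (fst ` S) (column S))" by simp
  also have "\<dots> = (\<Sum>i\<in>fst ` S. \<Sum>y\<in>column S i. f (i, y))"
    using assms by (subst sum.Sigma) (auto simp: finite_column)
  finally show ?thesis .
qed

lemma sum_by_rows:
  assumes "finite S"
  shows "sum f S = (\<Sum>j\<in>snd ` S. \<Sum>x\<in>row S j. f (x, j))"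
proof -
  have "S = prod.swap ` Sigma (snd ` S) (row S)" by (force simp: row_def)
  then have "sum f S = sum f (prod.swap ` Sigma (snd ` S) (row S))" by simp
  also have "\<dots> = sum (f \<circ> prod.swap) (Sigma (snd ` S) (row S))"
    by (rule sum.reindex) (auto simp: inj_on_def)
  also have "\<dots> = (\<Sum>j\<in>snd ` S. \<Sum>x\<in>row S j. f (x, j))"
    using assms by (subst sum.Sigma) (auto simp: finite_row case_prod_unfold prod.swap_def)
  finally show ?thesis .
qed

lemma pair_count_by_columns:
  assumes "finite S"
  shows "pair_count S w = (\<Sum>i\<in>fst ` S. \<Sum>k\<in>fst ` S.
    \<Sum>y\<in>column S i. \<Sum>z\<in>column S k. of_bool (w (i, y) (k, z)))"
  unfolding pair_count_def sum_by_columns[OF assms]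
  by (rule sum.cong[OF refl]) (rule sum.swap)

lemma pair_count_by_rows:
  assumes "finite S"
  shows "pair_count S w = (\<Sum>j\<in>snd ` S. \<Sum>k\<in>snd ` S.
    \<Sum>x\<in>row S j. \<Sum>z\<in>row S k. of_bool (w (x, j) (z, k)))"
  unfolding pair_count_def sum_by_rows[OF assms]
  by (rule sum.cong[OF refl]) (rule sum.swap)

section \<open>West gaps and column heights\<close>

definition west_gap :: "cell set \<Rightarrow> cell \<Rightarrow> cell \<Rightarrow> bool" where
  "west_gap S p q \<longleftrightarrow> fst q < fst p \<and> (fst q, snd p) \<notin> S"

text \<open>For columns \<open>k < i\<close>, the condition restricts \<open>p\<close> to the rows
  missing from column \<open>k\<close> and leaves \<open>q\<close> free in that column. By nesting,
  the number of such rows is the truncated difference of the heights.\<close>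

lemma west_gaps_by_heights:
  assumes "finite S" "nested S"
  shows "pair_count S (west_gap S) = (\<Sum>i\<in>fst ` S. \<Sum>k\<in>fst ` S.
    of_bool (k < i) * ((card (column S i) - card (column S k)) * card (column S k)))"
  unfolding pair_count_by_columns[OF assms(1)]
proof (intro sum.cong refl)
  fix i k
  have "card (column S i - column S k) = card (column S i) - card (column S k)"
    using nested_columns[OF assms(2), of i k] finite_column[OF assms(1)]
    by (auto simp: card_Diff_subset card_mono Diff_eq_empty_iff[THEN iffD2])
  moreover have "(\<Sum>y\<in>column S i. of_bool (y \<notin> column S k)) = card (column S i - column S k)"
    using finite_column[OF assms(1)] by (simp add: set_diff_eq Int_def)
  moreover have "(\<Sum>y\<in>column S i. \<Sum>z\<in>column S k. of_bool (west_gap S (i, y) (k, z)))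
      = (\<Sum>y\<in>column S i. of_bool (y \<notin> column S k) * (of_bool (k < i) * card (column S k)))"
    by (intro sum.cong refl) (auto simp: west_gap_def column_def)
  ultimately show "(\<Sum>y\<in>column S i. \<Sum>z\<in>column S k. of_bool (west_gap S (i, y) (k, z)))
      = of_bool (k < i) * ((card (column S i) - card (column S k)) * card (column S k))"
    unfolding sum_distrib_right[symmetric] by simp
qed

section \<open>South-east pairs between nested rows, counted as descents\<close>

definition descents :: "int set \<Rightarrow> int set \<Rightarrow> nat" where
  "descents R Q = (\<Sum>x\<in>R. \<Sum>z\<in>Q. of_bool (z < x))"

lemma descents_union_left:
  "finite R \<Longrightarrow> finite R' \<Longrightarrow> R \<inter> R' = {} \<Longrightarrow> descents (R \<union> R') Q = descents R Q + descents R' Q"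
  unfolding descents_def by (simp only: sum.union_disjoint)

lemma descents_union_right:
  "finite Q \<Longrightarrow> finite Q' \<Longrightarrow> Q \<inter> Q' = {} \<Longrightarrow> descents R (Q \<union> Q') = descents R Q + descents R Q'"
  unfolding descents_def by (simp only: sum.union_disjoint sum.distrib)

lemma descents_disjoint:
  assumes "R \<inter> Q = {}"
  shows "descents R Q + descents Q R = card R * card Q"
proof -
  have "descents R Q + descents Q R = (\<Sum>x\<in>R. \<Sum>z\<in>Q. of_bool (z < x) + of_bool (x < z))"
    unfolding descents_def sum.distrib by (simp only: sum.swap[of _ Q R])
  also have "\<dots> = (\<Sum>x\<in>R. \<Sum>z\<in>Q. 1)"
    using assms by (intro sum.cong refl) (auto simp: neq_iff)
  finally show ?thesis by simp
qed

lemma descents_self: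
  assumes "finite R"
  shows "2 * descents R R + card R = card R * card R"
proof -
  have "2 * descents R R + card R = descents R R + descents R R + (\<Sum>x\<in>R. \<Sum>z\<in>R. of_bool (z = x))"
    using assms by (simp add: if_distrib cong: if_cong)
  also have "descents R R + descents R R = (\<Sum>x\<in>R. \<Sum>z\<in>R. of_bool (z < x)) + (\<Sum>x\<in>R. \<Sum>z\<in>R. of_bool (x < z))"
    unfolding descents_def by (subst (2) sum.swap) (rule refl)
  also have "\<dots> + (\<Sum>x\<in>R. \<Sum>z\<in>R. of_bool (z = x)) = (\<Sum>x\<in>R. \<Sum>z\<in>R. 1)"
    unfolding sum.distrib[symmetric] by (intro sum.cong refl) auto
  finally show ?thesis by simp
qed

text \<open>The contribution to \<open>N + W\<close> modulo 2 of two rows of lengths \<open>l\<close> (the lower one) and \<open>l'\<close>.\<close>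

definition row_parity :: "nat \<Rightarrow> nat \<Rightarrow> nat" where
  "row_parity l l' = (if l \<le> l' then (l * l - l) div 2 else (l' * l' - l') div 2 + (l - l') * l')"

text \<open>If \<open>R \<subseteq> Q\<close>, the part \<open>descents R (Q - R)\<close> of
  \<open>descents R Q\<close> recurs as a gap term and cancels, which leaves the descents inside
  \<open>R\<close>. If \<open>Q \<subset> R\<close>, the gap term \<open>descents Q (R - Q)\<close>
  complements \<open>descents (R - Q) Q\<close> to a product of sizes.\<close>

lemma even_descents_nested:
  assumes fin: "finite R" "finite Q" and "R \<subseteq> Q \<or> Q \<subseteq> R"
  shows "even (descents R Q + (descents R (Q - R) + descents Q (R - Q)) + row_parity (card R) (card Q))"
proof -
  have self: "descents R R = (card R * card R - card R) div 2" if "finite R" for R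
    using descents_self[OF that] by simp
  have diff: "descents A (A \<union> B - A) = descents A (B - A)" for A B :: "int set"
    by (simp add: Un_Diff)
  show ?thesis
  proof (cases "R \<subseteq> Q")
    case True
    then have Q: "Q = R \<union> (Q - R)" by auto
    have "descents R Q = descents R R + descents R (Q - R)"
      using fin by (subst Q) (rule descents_union_right, auto)
    moreover have "descents Q (R - Q) = 0" using True by (simp add: descents_def Diff_eq_empty_iff[THEN iffD2])
    moreover have "row_parity (card R) (card Q) = descents R R"
      using True fin by (simp add: row_parity_def self card_mono)
    ultimately show ?thesis by simp blast
  next
    case False
    then have sub: "Q \<subset> R" using assms by auto
    then have R: "R = Q \<union> (R - Q)" by auto
    have "descents R Q = descents Q Q + descents (R - Q) Q"
      using fin by (subst R) (rule descents_union_left, auto)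
    moreover have "descents R (Q - R) = 0" using sub by (simp add: descents_def Diff_eq_empty_iff[THEN iffD2])
    moreover have "row_parity (card R) (card Q) = descents Q Q + (descents (R - Q) Q + descents Q (R - Q))"
      using sub fin descents_disjoint[of "R - Q" Q] psubset_card_mono[OF fin(1) sub]
      by (simp add: row_parity_def self card_Diff_subset Int_commute)
    ultimately show ?thesis by simp blast
  qed
qed

text \<open>Gap pairs run between two rows in either direction, south-east pairs only from a lower
  to a higher row; folding the first sum onto \<open>j < k\<close> lets the two be added term by
  term.\<close>

lemma sum_pairs_symmetrize:
  fixes f :: "'b::linorder \<Rightarrow> 'b \<Rightarrow> nat"
  assumes "\<And>j. f j j = 0"
  shows "(\<Sum>j\<in>J. \<Sum>k\<in>J. f j k) = (\<Sum>j\<in>J. \<Sum>k\<in>J. of_bool (j < k) * (f j k + f k j))"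
proof -
  have "(\<Sum>j\<in>J. \<Sum>k\<in>J. f j k)
      = (\<Sum>j\<in>J. \<Sum>k\<in>J. of_bool (j < k) * f j k + of_bool (k < j) * f j k)"
    using assms by (intro sum.cong refl) (auto simp: neq_iff)
  also have "\<dots> = (\<Sum>j\<in>J. \<Sum>k\<in>J. of_bool (j < k) * f j k) + (\<Sum>j\<in>J. \<Sum>k\<in>J. of_bool (j < k) * f k j)"
    unfolding sum.distrib by (subst (4) sum.swap) (rule refl)
  finally show ?thesis by (simp only: sum.distrib distrib_left)
qed

lemma south_east_west_gaps_by_lengths:
  assumes fin: "finite S" and "nested S"
  shows "even (pair_count S south_east + pair_count S (west_gap S)
    + (\<Sum>j\<in>snd ` S. \<Sum>k\<in>snd ` S. of_bool (j < k) * row_parity (card (row S j)) (card (row S k))))"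
proof -
  let ?R = "row S" and ?J = "snd ` S"
  have 1: "pair_count S south_east = (\<Sum>j\<in>?J. \<Sum>k\<in>?J. of_bool (j < k) * descents (?R j) (?R k))"
    unfolding pair_count_by_rows[OF fin] descents_def sum_distrib_left
    by (intro sum.cong refl) (auto simp: south_east_def)
  have "pair_count S (west_gap S) = (\<Sum>j\<in>?J. \<Sum>k\<in>?J. descents (?R j) (?R k - ?R j))"
    unfolding pair_count_by_rows[OF fin] descents_def
  proof ((rule sum.cong[OF refl])+)
    fix j k x
    \<comment> \<open>A token of row \<open>k\<close> forms a gap with row \<open>j\<close> only if
      its column is empty there, so the gaps become descents into
      \<open>?R k - ?R j\<close>.\<close>
    have "(\<Sum>z\<in>?R k. of_bool (west_gap S (x, j) (z, k))) = (\<Sum>z\<in>?R k - ?R j. of_bool (west_gap S (x, j) (z, k)))"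
      using finite_row[OF fin] by (intro sum.mono_neutral_right) (auto simp: west_gap_def row_def[of S j])
    also have "\<dots> = (\<Sum>z\<in>?R k - ?R j. of_bool (z < x))"
      by (intro sum.cong refl) (auto simp: west_gap_def row_def)
    finally show "(\<Sum>z\<in>?R k. of_bool (west_gap S (x, j) (z, k))) = (\<Sum>z\<in>?R k - ?R j. of_bool (z < x) :: nat)" .
  qed
  also have "\<dots> = (\<Sum>j\<in>?J. \<Sum>k\<in>?J. of_bool (j < k) *
      (descents (?R j) (?R k - ?R j) + descents (?R k) (?R j - ?R k)))"
    by (rule sum_pairs_symmetrize) (simp add: descents_def)
  finally have 2: "pair_count S (west_gap S) = \<dots>" .
  show ?thesis
    unfolding 1 2 sum.distrib[symmetric] distrib_left[symmetric]
    using even_descents_nested[OF finite_row[OF fin] finite_row[OF fin] nested_rows[OF \<open>nested S\<close>]]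
    by (intro dvd_sum dvd_mult)
qed

section \<open>Slides and their invariant\<close>

text \<open>The coordinate \<open>b\<close> numbers the lines, \<open>a\<close> orders the cells of a line; every line is moved
  by the same \<open>c\<close>, without overtaking within a line.\<close>

definition slides :: "(cell \<Rightarrow> int) \<Rightarrow> (cell \<Rightarrow> int) \<Rightarrow> 'a config \<Rightarrow> 'a config \<Rightarrow> bool" where
  "slides a b C D \<longleftrightarrow> (\<exists>m c. dom D = m ` dom C \<and> (\<forall>p\<in>dom C. D (m p) = C p \<and> b (m p) = b p + c) \<and>
     (\<forall>p\<in>dom C. \<forall>q\<in>dom C. b p = b q \<longrightarrow> (a (m p) < a (m q) \<longleftrightarrow> a p < a q)))"

lemma slides_trans:
  assumes "slides a b C D" "slides a b D E"
  shows "slides a b C E"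
proof -
  obtain m c where m: "dom D = m ` dom C" "\<forall>p\<in>dom C. D (m p) = C p \<and> b (m p) = b p + c"
    "\<forall>p\<in>dom C. \<forall>q\<in>dom C. b p = b q \<longrightarrow> (a (m p) < a (m q) \<longleftrightarrow> a p < a q)"
    using assms(1) unfolding slides_def by blast
  obtain n d where n: "dom E = n ` dom D" "\<forall>p\<in>dom D. E (n p) = D p \<and> b (n p) = b p + d"
    "\<forall>p\<in>dom D. \<forall>q\<in>dom D. b p = b q \<longrightarrow> (a (n p) < a (n q) \<longleftrightarrow> a p < a q)"
    using assms(2) unfolding slides_def by blast
  have D: "m p \<in> dom D" if "p \<in> dom C" for p using m(1) that by blast
  have "E ((n \<circ> m) p) = C p \<and> b ((n \<circ> m) p) = b p + (c + d)" if "p \<in> dom C" for p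
    using m(2)[rule_format, OF that] n(2)[rule_format, OF D[OF that]] by simp
  moreover have "a ((n \<circ> m) p) < a ((n \<circ> m) q) \<longleftrightarrow> a p < a q"
    if "p \<in> dom C" "q \<in> dom C" "b p = b q" for p q
    using m(2,3) n(3)[rule_format, OF D[OF that(1)] D[OF that(2)]] that by simp
  moreover have "dom E = (n \<circ> m) ` dom C" unfolding n(1) m(1) by (rule image_comp)
  ultimately show ?thesis unfolding slides_def by blast
qed

lemma slides_uminus_cell: "slides (\<lambda>p. - a p) b C D \<longleftrightarrow> slides a b C D"
proof -
  have "(\<forall>p\<in>S. \<forall>q\<in>S. b p = b q \<longrightarrow> (a (m q) < a (m p) \<longleftrightarrow> a q < a p)) \<longleftrightarrow>
      (\<forall>p\<in>S. \<forall>q\<in>S. b p = b q \<longrightarrow> (a (m p) < a (m q) \<longleftrightarrow> a p < a q))" for S m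
    by metis
  then show ?thesis unfolding slides_def neg_less_iff_less by (simp only:)
qed

lemma slides_uminus_line: "slides a (\<lambda>p. - b p) C D \<longleftrightarrow> slides a b C D"
proof -
  have *: "slides a (\<lambda>p. - b p) C D" if "slides a b C D" for b
  proof -
    obtain m c where "dom D = m ` dom C" "\<forall>p\<in>dom C. D (m p) = C p \<and> b (m p) = b p + c"
      "\<forall>p\<in>dom C. \<forall>q\<in>dom C. b p = b q \<longrightarrow> (a (m p) < a (m q) \<longleftrightarrow> a p < a q)"
      using \<open>slides a b C D\<close> unfolding slides_def by blast
    then show ?thesis unfolding slides_def
      by (intro exI[of _ m] exI[of _ "- c"]) simp
  qed
  from *[of b] *[of "\<lambda>p. - b p"] show ?thesis by auto
qed

lemma dom_comp_involution: "s \<circ> s = id \<Longrightarrow> dom (C \<circ> s) = s ` dom C"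
  by (force simp: dom_def fun_eq_iff image_iff)

lemma slides_conjugate:
  assumes s: "s \<circ> s = id" and "slides a b (C \<circ> s) D"
  shows "slides (a \<circ> s) (b \<circ> s) C (D \<circ> s)"
proof -
  have ss: "s (s p) = p" for p using s by (metis comp_apply id_apply)
  obtain m c where m: "dom D = m ` dom (C \<circ> s)" "\<forall>p\<in>dom (C \<circ> s). D (m p) = (C \<circ> s) p \<and> b (m p) = b p + c"
      "\<forall>p\<in>dom (C \<circ> s). \<forall>q\<in>dom (C \<circ> s). b p = b q \<longrightarrow> (a (m p) < a (m q) \<longleftrightarrow> a p < a q)"
    using assms(2) unfolding slides_def by blast
  have dom: "dom (D \<circ> s) = (s \<circ> m \<circ> s) ` dom C"
    unfolding dom_comp_involution[OF s] m(1) by (simp only: image_comp comp_assoc)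
  have sdom: "s p \<in> dom (C \<circ> s)" if "p \<in> dom C" for p
    using that by (auto simp: ss)
  have "(D \<circ> s) ((s \<circ> m \<circ> s) p) = C p \<and> (b \<circ> s) ((s \<circ> m \<circ> s) p) = (b \<circ> s) p + c"
    if "p \<in> dom C" for p
    using m(2)[rule_format, OF sdom[OF that]] by (simp add: ss)
  moreover have "(a \<circ> s) ((s \<circ> m \<circ> s) p) < (a \<circ> s) ((s \<circ> m \<circ> s) q) \<longleftrightarrow> (a \<circ> s) p < (a \<circ> s) q"
    if "p \<in> dom C" "q \<in> dom C" "(b \<circ> s) p = (b \<circ> s) q" for p q
    using m(3)[rule_format, OF sdom[OF that(1)] sdom[OF that(2)]] that(3) by (simp add: ss)
  ultimately show ?thesis unfolding slides_def dom by blast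
qed

lemma slides_configuration:
  assumes "slides a b C D" "configuration C"
  shows "configuration D" "ran D = ran C"
proof -
  obtain m where m: "dom D = m ` dom C" "\<And>p. p \<in> dom C \<Longrightarrow> D (m p) = C p"
    using assms(1) unfolding slides_def by blast
  have "inj_on D (m ` dom C)"
  proof (rule inj_onI)
    fix x y assume "x \<in> m ` dom C" "y \<in> m ` dom C" "D x = D y"
    then obtain p q where "x = m p" "y = m q" "p \<in> dom C" "q \<in> dom C" by (elim imageE)
    then show "x = y"
      using \<open>D x = D y\<close> m(2) assms(2) by (metis configuration_def inj_onD)
  qed
  then show "configuration D"
    using assms(2) unfolding configuration_def m(1) by (simp only: finite_imageI)
  have "D ` dom D = C ` dom C"
    unfolding m(1) image_image by (intro image_cong refl m(2))
  moreover have "Some ` ran B = B ` dom B" for B :: "'a config"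
    by (force simp: ran_def dom_def)
  ultimately show "ran D = ran C" by (metis inj_image_eq_iff inj_Some)
qed

text \<open>As all lines shift by one \<open>c\<close> and keep their inner order, the reading
  sequence of the labels stays the same. The map \<open>m\<close> is injective because distinct
  labels recover \<open>p\<close> from \<open>m p\<close>.\<close>

lemma slides_inversions:
  assumes "slides a b C D" "configuration C"
  shows "inversions (lex_before b a) (f \<circ> D) (dom D) = inversions (lex_before b a) (f \<circ> C) (dom C)"
proof -
  obtain m c where m: "dom D = m ` dom C" "\<forall>p\<in>dom C. D (m p) = C p \<and> b (m p) = b p + c"
    "\<forall>p\<in>dom C. \<forall>q\<in>dom C. b p = b q \<longrightarrow> (a (m p) < a (m q) \<longleftrightarrow> a p < a q)"
    using assms(1) unfolding slides_def by blast
  have "inj_on m (dom C)"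
    using assms(2) m(2) unfolding configuration_def inj_on_def by metis
  moreover have "lex_before b a (m p) (m q) \<longleftrightarrow> lex_before b a p q" if "p \<in> dom C" "q \<in> dom C" for p q
    using m(2,3) that unfolding lex_before_def by auto
  moreover have "D (m p) = C p" if "p \<in> dom C" for p using m(2) that by blast
  ultimately show ?thesis
    unfolding inversions_def m(1)
    by (simp add: pair_count_image del: domIff cong: pair_count_cong)
qed

lemma slides_line_sizes:
  assumes "slides a b C D" "configuration C"
  obtains c where "b ` dom D = (\<lambda>j. j + c) ` b ` dom C"
    "\<And>j. card {p \<in> dom D. b p = j + c} = card {p \<in> dom C. b p = j}"
proof -
  obtain m c where m: "dom D = m ` dom C" "\<And>p. p \<in> dom C \<Longrightarrow> D (m p) = C p"
    "\<And>p. p \<in> dom C \<Longrightarrow> b (m p) = b p + c"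
    using assms(1) unfolding slides_def by blast
  have inj: "inj_on m (dom C)"
    using assms(2) m(2) unfolding configuration_def inj_on_def by metis
  show thesis
  proof
    show "b ` dom D = (\<lambda>j. j + c) ` b ` dom C"
      unfolding m(1) image_image by (intro image_cong refl m(3))
    fix j
    have "{p \<in> dom D. b p = j + c} = m ` {p \<in> dom C. b p = j}"
    proof -
      have "{p \<in> m ` dom C. b p = j + c} = m ` {p \<in> dom C. b (m p) = j + c}" by blast
      also have "{p \<in> dom C. b (m p) = j + c} = {p \<in> dom C. b p = j}"
        by (intro Collect_cong conj_cong refl) (simp add: m(3))
      finally show ?thesis unfolding m(1) .
    qed
    then show "card {p \<in> dom D. b p = j + c} = card {p \<in> dom C. b p = j}"
      using inj by (simp add: card_image inj_on_def)
  qed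
qed

text \<open>A common shift keeps the sizes and the order of the lines. Rows use this with
  \<open>row_parity\<close> for \<open>f\<close>, columns with the gap count.\<close>

lemma slides_line_sum:
  assumes "slides a b C D" "configuration C"
  shows "(\<Sum>j\<in>b ` dom D. \<Sum>k\<in>b ` dom D. of_bool (j < k) *
        f (card {p \<in> dom D. b p = j}) (card {p \<in> dom D. b p = k}))
    = (\<Sum>j\<in>b ` dom C. \<Sum>k\<in>b ` dom C. of_bool (j < k) *
        (f (card {p \<in> dom C. b p = j}) (card {p \<in> dom C. b p = k}) :: nat))"
proof -
  obtain c where c: "b ` dom D = (\<lambda>j. j + c) ` b ` dom C"
    "\<And>j. card {p \<in> dom D. b p = j + c} = card {p \<in> dom C. b p = j}"
    using slides_line_sizes[OF assms] by blast
  have "inj_on (\<lambda>j. j + c) A" for A by (simp add: inj_on_def)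
  note reindex = sum.reindex[OF this]
  show ?thesis
    unfolding c(1) reindex comp_def c(2) add_less_cancel_right ..
qed

text \<open>The quantity \<open>I + N + W\<close> with invariant parity; \<open>f\<close> turns
  labels into numbers that can be compared.\<close>

definition energy :: "('a option \<Rightarrow> nat) \<Rightarrow> 'a config \<Rightarrow> nat" where
  "energy f C = inversions (lex_before snd fst) (f \<circ> C) (dom C)
     + pair_count (dom C) south_east + pair_count (dom C) (west_gap (dom C))"

lemma even_energy_row_slide:
  assumes "slides fst snd C D" "configuration C" "nested (dom C)" "nested (dom D)"
  shows "even (energy f D) \<longleftrightarrow> even (energy f C)"
proof -
  have fin: "finite (dom C)" "finite (dom D)"
    using assms slides_configuration unfolding configuration_def by blast+
  let ?sum = "\<lambda>S. \<Sum>j\<in>snd ` S. \<Sum>k\<in>snd ` S. of_bool (j < k) * row_parity (card (row S j)) (card (row S k))"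
  have "?sum (dom D) = ?sum (dom C)"
    unfolding card_row by (rule slides_line_sum[OF assms(1,2)])
  moreover have "inversions (lex_before snd fst) (f \<circ> D) (dom D) = inversions (lex_before snd fst) (f \<circ> C) (dom C)"
    by (rule slides_inversions[OF assms(1,2)])
  ultimately show ?thesis
    using south_east_west_gaps_by_lengths[OF fin(1) assms(3)] south_east_west_gaps_by_lengths[OF fin(2) assms(4)]
    unfolding energy_def by (simp only: even_add) blast
qed

text \<open>Modulo 2 the energy is the number of column-first inversions plus the gap count, since
  the south-east pairs convert one inversion count into the other. A column slide preserves both
  terms.\<close>

lemma even_energy_column_slide:
  assumes "slides snd fst C D" "configuration C" "nested (dom C)" "nested (dom D)"
    and inj: "inj_on (f \<circ> C) (dom C)" "inj_on (f \<circ> D) (dom D)"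
  shows "even (energy f D) \<longleftrightarrow> even (energy f C)"
proof -
  have fin: "finite (dom C)" "finite (dom D)"
    using assms slides_configuration unfolding configuration_def by blast+
  have gaps: "pair_count S (west_gap S) = (\<Sum>k\<in>fst ` S. \<Sum>i\<in>fst ` S.
    of_bool (k < i) * ((card (column S i) - card (column S k)) * card (column S k)))"
    if "finite S" "nested S" for S
    unfolding west_gaps_by_heights[OF that] by (rule sum.swap)
  have "pair_count (dom D) (west_gap (dom D)) = pair_count (dom C) (west_gap (dom C))"
    unfolding gaps[OF fin(1) assms(3)] gaps[OF fin(2) assms(4)] card_column
    by (rule slides_line_sum[OF assms(1,2), where f = "\<lambda>k i. (i - k) * k"])
  moreover have "inversions (lex_before fst snd) (f \<circ> D) (dom D) = inversions (lex_before fst snd) (f \<circ> C) (dom C)"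
    by (rule slides_inversions[OF assms(1,2)])
  ultimately show ?thesis
    using even_row_col_inversions[OF inj(1)] even_row_col_inversions[OF inj(2)]
    unfolding energy_def by (simp only: even_add) blast
qed

section \<open>Pushes\<close>

text \<open>In each row the occupancies of columns \<open>i - 1\<close> and \<open>i\<close> become
  their disjunction and their conjunction. Both are monotone, which is why row inclusions
  survive.\<close>

lemma dom_move_column:
  "(x, j) \<in> dom (move_column i C) \<longleftrightarrow>
    (if x = i - 1 then (i - 1, j) \<in> dom C \<or> (i, j) \<in> dom C
     else if x = i then (i - 1, j) \<in> dom C \<and> (i, j) \<in> dom C
     else (x, j) \<in> dom C)"
  by (auto simp: move_column_def dom_def)

lemma nested_move_column:
  assumes "nested (dom C)"
  shows "nested (dom (move_column i C))"
proof -
  have "row (dom (move_column i C)) j \<subseteq> row (dom (move_column i C)) k"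
    if "row (dom C) j \<subseteq> row (dom C) k" for j k
  proof
    have *: "(x, j) \<in> dom C \<Longrightarrow> (x, k) \<in> dom C" for x
      using that unfolding row_def by blast
    fix x assume "x \<in> row (dom (move_column i C)) j"
    then show "x \<in> row (dom (move_column i C)) k"
      using *[of i] *[of "i - 1"] *[of x]
      unfolding row_def mem_Collect_eq dom_move_column by (auto split: if_splits)
  qed
  then show ?thesis using assms unfolding nested_iff_rows by blast
qed

section \<open>Tracking single tokens through a column move\<close>

definition column_step :: "int \<Rightarrow> cell set \<Rightarrow> cell \<Rightarrow> cell" where
  "column_step i S p = (if fst p = i \<and> (i - 1, snd p) \<notin> S then (i - 1, snd p) else p)"

lemma move_column_step:
  assumes "p \<in> dom C"
  shows "move_column i C (column_step i (dom C) p) = C p"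
  using assms by (cases p) (auto simp: column_step_def move_column_def)

lemma dom_move_column_step: "dom (move_column i C) = column_step i (dom C) ` dom C"
proof (intro equalityI subsetI)
  fix p assume "p \<in> column_step i (dom C) ` dom C"
  then obtain q where "q \<in> dom C" "p = column_step i (dom C) q" by blast
  then show "p \<in> dom (move_column i C)"
    using move_column_step[of q C i] unfolding dom_def by simp
next
  fix p assume p: "p \<in> dom (move_column i C)"
  show "p \<in> column_step i (dom C) ` dom C"
  proof (cases "fst p = i - 1 \<and> p \<notin> dom C")
    case True
    then have p_eq: "p = (i - 1, snd p)" by (simp add: prod_eq_iff)
    with True have "(i - 1, snd p) \<notin> dom C" by simp
    moreover from this have "(i, snd p) \<in> dom C"
      using p p_eq dom_move_column[of "i - 1" "snd p" i C] by simp
    ultimately show ?thesis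
      by (intro image_eqI[of _ _ "(i, snd p)"]) (use p_eq in \<open>simp_all add: column_step_def\<close>)
  next
    case False
    then have "p \<in> dom C" "fst p = i \<Longrightarrow> (i - 1, snd p) \<in> dom C"
      using p dom_move_column[of "fst p" "snd p" i C] by (metis prod.collapse)+
    then show ?thesis
      by (intro image_eqI[of _ _ p]) (auto simp: column_step_def)
  qed
qed

text \<open>A token moves only into an empty neighbouring cell, so column \<open>i - 1\<close> holds
  no token of that row to collide with.\<close>

lemma column_step_less:
  assumes "p \<in> S" "q \<in> S" "snd p = snd q"
  shows "fst (column_step i S p) < fst (column_step i S q) \<longleftrightarrow> fst p < fst q"
proof -
  have "fst p \<noteq> i - 1" if "(i - 1, snd q) \<notin> S"
    using that assms by (metis prod.collapse)
  moreover have "fst q \<noteq> i - 1" if "(i - 1, snd q) \<notin> S"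
    using that assms by (metis prod.collapse)
  ultimately show ?thesis
    using assms(3) unfolding column_step_def by auto
qed

lemma slides_move_column: "slides fst snd C (move_column i C)"
  unfolding slides_def
proof (intro exI conjI)
  show "dom (move_column i C) = column_step i (dom C) ` dom C" by (rule dom_move_column_step)
  show "\<forall>p\<in>dom C. move_column i C (column_step i (dom C) p) = C p
      \<and> snd (column_step i (dom C) p) = snd p + 0"
    by (intro ballI conjI move_column_step) (simp_all add: column_step_def)
qed (simp add: column_step_less)

lemma dom_translate: "dom (translate v C) = (\<lambda>p. p + v) ` dom C"
proof (rule set_eqI)
  fix q
  have "q \<in> dom (translate v C) \<longleftrightarrow> q - v \<in> dom C" by (simp add: translate_def domIff)
  also have "\<dots> \<longleftrightarrow> q \<in> (\<lambda>p. p + v) ` dom C"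
    by (metis (no_types, lifting) add_diff_cancel diff_add_cancel image_iff)
  finally show "q \<in> dom (translate v C) \<longleftrightarrow> q \<in> (\<lambda>p. p + v) ` dom C" .
qed

lemma slides_translate: "slides fst snd C (translate v C)"
  unfolding slides_def
  by (intro exI[of _ "\<lambda>p. p + v"] exI[of _ "snd v"] conjI dom_translate) (simp_all add: translate_def)

lemma nested_translate:
  assumes "nested (dom C)"
  shows "nested (dom (translate v C))"
proof -
  have mem: "(x, j) \<in> dom (translate v C) \<longleftrightarrow> (x - fst v, j - snd v) \<in> dom C" for x j
    by (cases v) (simp add: translate_def domIff)
  show ?thesis using assms unfolding nested_def mem by blast
qed

lemma push_left_slides:
  assumes "nested (dom C)"
  shows "slides fst snd C (push_left C) \<and> nested (dom (push_left C))"
proof -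
  have "slides fst snd C (fold move_column ks D) \<and> nested (dom (fold move_column ks D))"
    if "slides fst snd C D" "nested (dom D)" for D and ks :: "int list"
    using that
    by (induction ks arbitrary: D) (simp_all add: nested_move_column slides_trans[OF _ slides_move_column])
  then show ?thesis
    unfolding push_left_def Let_def
    using slides_translate nested_translate[OF assms] by blast
qed

lemma symmetry_involution: "symmetry d \<circ> symmetry d = id"
  by (rule ext, case_tac x, cases d) simp_all

lemma nested_symmetry:
  assumes "nested (dom C)"
  shows "nested (dom (C \<circ> symmetry d))"
proof -
  have mem: "(x, j) \<in> dom (C \<circ> symmetry d) \<longleftrightarrow> symmetry d (x, j) \<in> dom C" for x j
    by (simp add: domIff)
  show ?thesis
    using assms unfolding nested_def mem
    by (cases d; simp only: symmetry.simps) blast+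
qed

text \<open>The left push is conjugated by the symmetry of \<open>d\<close>. Sign changes of the
  coordinates are absorbed by \<open>slides_uminus_cell\<close> and
  \<open>slides_uminus_line\<close>.\<close>

lemma push_slides:
  assumes "nested (dom C)"
  shows "nested (dom (push d C))"
    and "slides fst snd C (push d C) \<or> slides snd fst C (push d C)"
proof -
  let ?s = "symmetry d"
  have P: "slides fst snd (C \<circ> ?s) (push_left (C \<circ> ?s))" "nested (dom (push_left (C \<circ> ?s)))"
    using push_left_slides[OF nested_symmetry[OF assms]] by blast+
  show "nested (dom (push d C))"
    unfolding push_def by (rule nested_symmetry[OF P(2)])
  have S: "slides (fst \<circ> ?s) (snd \<circ> ?s) C (push d C)"
    unfolding push_def by (rule slides_conjugate[OF symmetry_involution P(1)])
  show "slides fst snd C (push d C) \<or> slides snd fst C (push d C)"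
  proof (cases d)
    case Left
    then have "fst \<circ> ?s = fst" "snd \<circ> ?s = snd" by auto
    then show ?thesis using S by simp
  next
    case Right
    then have "fst \<circ> ?s = (\<lambda>p. - fst p)" "snd \<circ> ?s = snd" by auto
    then show ?thesis using S by (simp add: slides_uminus_cell)
  next
    case Up
    then have "fst \<circ> ?s = (\<lambda>p. - snd p)" "snd \<circ> ?s = (\<lambda>p. - fst p)" by auto
    then show ?thesis using S by (simp add: slides_uminus_cell slides_uminus_line)
  next
    case Down
    then have "fst \<circ> ?s = snd" "snd \<circ> ?s = fst" by auto
    then show ?thesis using S by simp
  qed
qed

lemma even_energy_push:
  assumes "configuration C" "nested (dom C)" and f: "inj_on f (Some ` ran C)"
  shows "configuration (push d C)" "ran (push d C) = ran C" "even (energy f (push d C)) \<longleftrightarrow> even (energy f C)"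
proof -
  note N = push_slides(1)[OF assms(2), of d]
  have inj: "inj_on (f \<circ> D) (dom D)" if "configuration D" "ran D = ran C" for D
  proof (rule comp_inj_on)
    show "inj_on D (dom D)" using that(1) unfolding configuration_def by blast
    have "D ` dom D \<subseteq> Some ` ran C" unfolding that(2)[symmetric] by (auto simp: ran_def)
    then show "inj_on f (D ` dom D)" by (rule inj_on_subset[OF f])
  qed
  show C: "configuration (push d C)" "ran (push d C) = ran C"
    using push_slides(2)[OF assms(2), of d] slides_configuration[OF _ assms(1)] by blast+
  show "even (energy f (push d C)) \<longleftrightarrow> even (energy f C)"
    using push_slides(2)[OF assms(2), of d]
      even_energy_row_slide[OF _ assms(1,2) N] even_energy_column_slide[OF _ assms(1,2) N inj[OF assms(1) refl] inj[OF C]]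
    by blast
qed

lemma even_energy_pushes:
  assumes "configuration C" "nested (dom C)" "inj_on f (Some ` ran C)"
  shows "even (energy f (fold push ds C)) \<longleftrightarrow> even (energy f C)"
  using assms
proof (induction ds arbitrary: C)
  case (Cons d ds)
  then show ?case
    using even_energy_push[OF Cons.prems, of d] push_slides(1)[OF Cons.prems(2), of d] by simp
qed simp

section \<open>Canonical configurations are nested\<close>

lemma inj_on_column_step: "inj_on (column_step i S) S"
proof (rule inj_onI)
  fix p q assume *: "p \<in> S" "q \<in> S" "column_step i S p = column_step i S q"
  have "snd (column_step i S r) = snd r" for r by (simp add: column_step_def)
  then have "snd p = snd q" using *(3) by metis
  then show "p = q"
    using * column_step_less[of p S q i] column_step_less[of q S p i] by (simp add: prod_eq_iff)
qed

text \<open>The sum of the column numbers is a potential that every moved token lowers by one; if it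
  does not drop, no token of column \<open>i\<close> had an empty cell to its left.\<close>

lemma sum_fst_move_column:
  assumes fin: "finite (dom C)"
  shows "sum fst (dom (move_column i C)) \<le> sum fst (dom C)"
    and "sum fst (dom C) \<le> sum fst (dom (move_column i C)) \<Longrightarrow> (i, j) \<in> dom C \<Longrightarrow> (i - 1, j) \<in> dom C"
proof -
  let ?m = "column_step i (dom C)"
  have eq: "sum fst (dom (move_column i C)) = (\<Sum>p\<in>dom C. fst (?m p))"
    unfolding dom_move_column_step by (simp add: sum.reindex inj_on_column_step)
  have le: "fst (?m p) \<le> fst p" for p by (simp add: column_step_def)
  show "sum fst (dom (move_column i C)) \<le> sum fst (dom C)"
    unfolding eq by (intro sum_mono le)
  assume ge: "sum fst (dom C) \<le> sum fst (dom (move_column i C))" and ij: "(i, j) \<in> dom C"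
  show "(i - 1, j) \<in> dom C"
  proof (rule ccontr)
    assume "(i - 1, j) \<notin> dom C"
    then have "fst (?m (i, j)) < fst (i, j)" by (simp add: column_step_def)
    then have "(\<Sum>p\<in>dom C. fst (?m p)) < sum fst (dom C)"
      using fin ij le by (intro sum_strict_mono_ex1) blast+
    then show False using ge eq by simp
  qed
qed

lemma finite_dom_move_column: "finite (dom C) \<Longrightarrow> finite (dom (move_column i C))"
  unfolding dom_move_column_step by simp

lemma sum_fst_fold_move_column:
  "finite (dom C) \<Longrightarrow> sum fst (dom (fold move_column ks C)) \<le> sum fst (dom C)"
proof (induction ks arbitrary: C)
  case (Cons k ks)
  have "sum fst (dom (fold move_column ks (move_column k C))) \<le> sum fst (dom (move_column k C))"
    by (rule Cons.IH[OF finite_dom_move_column[OF Cons.prems]])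
  also have "\<dots> \<le> sum fst (dom C)" by (rule sum_fst_move_column(1)[OF Cons.prems])
  finally show ?case by simp
qed simp

text \<open>Since the potential never grows, no loss at the end forces every column move to be
  trivial. Hence the configuration is still \<open>C\<close> when column \<open>i\<close> is
  treated.\<close>

lemma fold_move_column_stuck:
  assumes "finite (dom C)" "sum fst (dom C) \<le> sum fst (dom (fold move_column ks C))"
    and "i \<in> set ks" "(i, j) \<in> dom C"
  shows "(i - 1, j) \<in> dom C"
  using assms(1-3)
proof (induction ks)
  case (Cons k ks)
  note fin = \<open>finite (dom C)\<close>
  have "sum fst (dom C) \<le> sum fst (dom (move_column k C))"
    using Cons.prems(2) sum_fst_fold_move_column[OF finite_dom_move_column[OF fin], of ks k] by simp
  note stuck = sum_fst_move_column(2)[OF fin this]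
  have "move_column k C = C"
    using stuck by (fastforce simp: move_column_def fun_eq_iff)
  then show ?case
    using Cons stuck[of j] assms(4) by auto
qed simp

text \<open>Moves out of columns from 1 onwards neither empty column 0 nor pass beyond it. This
  later pins down the horizontal part of a translation.\<close>

lemma fold_move_column_west_border:
  assumes "\<forall>k\<in>set ks. 1 \<le> k" "\<forall>p\<in>dom C. 0 \<le> fst p" "\<exists>j. (0, j) \<in> dom C"
  shows "(\<forall>p\<in>dom (fold move_column ks C). 0 \<le> fst p) \<and> (\<exists>j. (0, j) \<in> dom (fold move_column ks C))"
  using assms
proof (induction ks arbitrary: C)
  case (Cons k ks)
  have "\<forall>p\<in>dom (move_column k C). 0 \<le> fst p"
    unfolding dom_move_column_step using Cons.prems(1,2) by (auto simp: column_step_def simp del: domIff)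
  moreover have "\<exists>j. (0, j) \<in> dom (move_column k C)"
    using Cons.prems(1,3) unfolding dom_move_column by auto
  ultimately show ?case
    using Cons by simp
qed simp

text \<open>A left push that restores the shape moves no token after the normalising translation, so
  every row fills an interval starting at the west border. Such intervals are nested.\<close>

lemma canonical_nested:
  assumes "canonical C"
  shows "nested (dom C)"
proof (cases "dom C = {}")
  case True
  then show ?thesis by (simp add: nested_def)
next
  case False
  have fin: "finite (dom C)" using assms unfolding canonical_def configuration_def by blast
  define l where "l = lower_left C"
  define D where "D = translate (- l) C"
  define ks where "ks = [1..Max (fst ` dom D)]"
  have ks: "\<forall>k\<in>set ks. 1 \<le> k" by (simp add: ks_def)
  have "symmetry Left = id" by (rule ext) (simp add: split_paired_all)
  then have push: "push Left C = fold move_column ks D"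
    unfolding push_def push_left_def Let_def D_def ks_def l_def by (simp only: comp_id)
  have "same_shape C (fold move_column ks D)"
    using assms unfolding canonical_def push by (elim conjE)
  then obtain v where v: "dom (fold move_column ks D) = (\<lambda>p. p + v) ` dom C"
    unfolding same_shape_def by blast
  have dom_D: "dom D = (\<lambda>p. p + - l) ` dom C" unfolding D_def dom_translate ..
  have fin_D: "finite (dom D)" using fin dom_D by simp
  have l_le: "fst l \<le> fst p" if "p \<in> dom C" for p
    using that fin unfolding l_def lower_left_def by simp
  have "fst l \<in> fst ` dom C"
    using False fin unfolding l_def lower_left_def by (simp only: fst_conv) (rule Min_in, auto)
  then obtain p0 where p0: "p0 \<in> dom C" "fst p0 = fst l" by (metis imageE)
  have D_ge: "\<forall>p\<in>dom D. 0 \<le> fst p" unfolding dom_D using l_le by simp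
  have "p0 + - l \<in> dom D" unfolding dom_D by (rule imageI[OF p0(1)])
  moreover have "fst (p0 + - l) = 0" using p0(2) by simp
  ultimately have "\<exists>j. (0, j) \<in> dom D" by (metis prod.collapse)
  \<comment> \<open>Column 0 is the west border before and after the column moves. Comparing it with
    the border of \<open>dom C\<close> shifted by \<open>v\<close> gives the horizontal part of
    \<open>v\<close>, and thereby equal potentials.\<close>
  note border = fold_move_column_west_border[OF ks D_ge this]
  have "0 \<le> fst (p0 + v)" using border p0(1) unfolding v by blast
  then have "0 \<le> fst l + fst v" by (simp add: p0(2))
  moreover have "fst l + fst v \<le> 0"
  proof -
    obtain p where "p \<in> dom C" "fst (p + v) = 0" using border unfolding v by (metis fst_conv imageE)
    then show ?thesis using l_le[of p] by simp
  qed
  ultimately have v_l: "fst v = fst (- l)" by simp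
  have sums: "sum fst (dom (fold move_column ks D)) = sum fst (dom D)"
    unfolding v dom_D by (simp add: sum.reindex inj_on_def v_l)
  have step: "(i - 1, j) \<in> dom D" if "(i, j) \<in> dom D" "1 \<le> i" for i j
  proof (rule fold_move_column_stuck[OF fin_D _ _ that(1)])
    show "sum fst (dom D) \<le> sum fst (dom (fold move_column ks D))" by (simp only: sums)
    have "fst (i, j) \<le> Max (fst ` dom D)"
      by (intro Max_ge finite_imageI fin_D imageI that(1))
    then show "i \<in> set ks" using that(2) unfolding ks_def by simp
  qed
  have down: "(i - int n, j) \<in> dom D" if "(i, j) \<in> dom D" "int n \<le> i" for i j n
    using that(2)
  proof (induction n)
    case (Suc n)
    then show ?case using step[of "i - int n" j] by (simp add: algebra_simps)
  qed (use that(1) in simp)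
  have "nested (dom D)"
    unfolding nested_def
  proof (intro allI impI)
    fix x j x' k assume *: "(x, j) \<in> dom D" "(x', k) \<in> dom D"
    then have "0 \<le> x" "0 \<le> x'" using D_ge by (metis fst_conv)+
    \<comment> \<open>The token further east has its row filled back to column 0, including the cell
      in the other token's column.\<close>
    then show "(x', j) \<in> dom D \<or> (x, k) \<in> dom D"
      using down[OF *(1), of "nat (x - x')"] down[OF *(2), of "nat (x' - x)"] by (cases "x' \<le> x") auto
  qed
  moreover have "C = translate l D" by (simp add: D_def translate_def)
  ultimately show ?thesis using nested_translate by metis
qed

section \<open>Comparing parities before and after a shape-restoring sequence\<close>

theorem theorem2:
  fixes C :: "'a config" and \<pi> :: "cell \<Rightarrow> cell"
  assumes "canonical C" and "\<pi> \<in> push_group C"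
  shows "evenperm \<pi>"
proof -
  let ?lex = "lex_before snd fst" and ?S = "dom C"
  have C: "configuration C" and nested: "nested ?S"
    using assms(1) canonical_nested unfolding canonical_def by blast+
  then have fin: "finite ?S" unfolding configuration_def by blast
  obtain ds v where \<pi>: "\<pi> permutes ?S" and dom: "dom (fold push ds C) = (\<lambda>p. p + v) ` ?S"
    and pos: "\<forall>p\<in>?S. fold push ds C (\<pi> p + v) = C p"
    using assms(2) unfolding push_group_def by blast
  define D where "D = fold push ds C"
  \<comment> \<open>The labels carry no order; an injective numbering of those present serves as a
    ranking.\<close>
  have "finite (Some ` ran C)" using finite_ran[OF fin] by simp
  then obtain f :: "'a option \<Rightarrow> nat" where f: "inj_on f (Some ` ran C)"
    using finite_imp_inj_to_nat_seg by metis
  \<comment> \<open>\<open>g\<close> reads the final labels at the cells of \<open>C\<close>, with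
    the translation by \<open>v\<close> undone. Then \<open>g \<circ> \<pi>\<close> is the initial
    ranking, so the sign of \<open>\<pi>\<close> compares the inversions before and after.\<close>
  define g where "g p = f (D (p + v))" for p
  have g\<pi>: "(g \<circ> \<pi>) p = (f \<circ> C) p" if "p \<in> ?S" for p
    using pos that by (simp add: g_def D_def)
  have "inj_on (f \<circ> C) ?S"
  proof (rule comp_inj_on)
    show "inj_on C ?S" using C unfolding configuration_def by blast
    show "inj_on f (C ` ?S)" by (rule inj_on_subset[OF f]) (auto simp: ran_def)
  qed
  then have "inj_on (g \<circ> \<pi>) ?S" using g\<pi> inj_on_cong by blast
  then have inj: "inj_on g ?S" using permutes_image[OF \<pi>] inj_on_imageI by metis
  have shift: "inj_on (\<lambda>p. p + v) A" for A :: "cell set" by (simp add: inj_on_def)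
  have "pair_count (dom D) south_east = pair_count ?S south_east"
    unfolding D_def dom pair_count_image[OF shift] by (simp add: south_east_def[abs_def])
  moreover have "pair_count (dom D) (west_gap (dom D)) = pair_count ?S (west_gap ?S)"
  proof -
    have "(x + fst v, y + snd v) \<in> (\<lambda>p. p + v) ` ?S \<longleftrightarrow> (x, y) \<in> ?S" for x y
      using inj_image_mem_iff[OF shift, of "(x, y)" ?S] by (simp add: plus_prod_def)
    then show ?thesis
      unfolding D_def dom pair_count_image[OF shift] by (simp add: west_gap_def[abs_def])
  qed
  moreover have "inversions ?lex (f \<circ> D) (dom D) = inversions ?lex g ?S"
    unfolding D_def dom inversions_def pair_count_image[OF shift]
    by (simp add: lex_before_def g_def D_def)
  moreover have "inversions ?lex (f \<circ> C) ?S = inversions ?lex (g \<circ> \<pi>) ?S"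
    unfolding inversions_def using g\<pi> by (intro pair_count_cong) simp
  moreover have "even (energy f D) \<longleftrightarrow> even (energy f C)"
    unfolding D_def by (rule even_energy_pushes[OF C nested f])
  \<comment> \<open>The south-east and gap counts of \<open>C\<close> and \<open>D\<close> coincide,
    so equal energy parities leave equal inversion parities.\<close>
  ultimately have "even (inversions ?lex (g \<circ> \<pi>) ?S + inversions ?lex g ?S)"
    unfolding energy_def by (simp only: even_add) blast
  then show ?thesis
    by (subst inversions_permutes[OF fin \<pi> inj, of ?lex]) (auto simp: lex_before_def prod_eq_iff)
qed

end
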